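(* Let $X$ be a topological group and let $\mathrm{Aut}(X)$ be the group of all bicontinuous group automorphisms of $X$. On $\mathrm{Aut}(X)$, the three uniform structures of uniform convergence on bounded sets of $X$ taken with respect to the left, the right, or the upper uniform structure on $X$ agree with each other.
   Context: Uniform structures on a topological group $X$: the left uniform structure is generated by the entourages $\{(x,y) \mid x^{-1}y \in V\}$, the right one by $\{(x,y) \mid xy^{-1} \in V\}$, and the upper one by $\{(x,y) \mid x^{-1}y \in V,\ xy^{-1} \in V\}$, where $V$ runs among identity neighborhoods. A subset $B$ of a topological group $X$ is bounded if for every increasing sequence $V_1 \subseteq V_2 \subseteq \dots$ of open subsets of $X$ with $\bigcup_n V_n = X$ and $V_n^2 \subseteq V_{n+1}$ for all $n$, there is an index $k$ with $B \subseteq V_k$. For a given uniform structure $\mathscr{U}$ on $X$, the uniform structure of uniform convergence on bounded sets with respect to $\mathscr{U}$ on a set of maps $X \to X$ is the one generated by the finite intersections of the sets $\{(f,g) \mid \forall x \in B,\ (f(x),g(x)) \in E\}$, with $B$ bounded in $X$ and $E \in \mathscr{U}$. *)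

theory Defs
  imports "HOL-Algebra.Bij" "HOL-Algebra.Coset" "HOL-Analysis.Analysis"
begin

text \<open>The topology is not assumed to be Hausdorff.\<close>

locale topological_group = group G for G (structure) +
  fixes T :: "'a topology"
  assumes topspace_eq_carrier: "topspace T = carrier G"
    and continuous_mult: "continuous_map (prod_topology T T) T (\<lambda>(x, y). x \<otimes> y)"
    and continuous_inverse: "continuous_map T T (\<lambda>x. inv x)"

text \<open>The carrier consists of extensional functions, as it does for \<^const>\<open>AutoGroup\<close>.\<close>

definition bicontinuous_AutoGroup ::
    "('a, 'b) monoid_scheme \<Rightarrow> 'a topology \<Rightarrow> ('a \<Rightarrow> 'a) monoid" where
  "bicontinuous_AutoGroup G T = AutoGroup G
     \<lparr>carrier := {f \<in> auto G. continuous_map T T f \<and> continuous_map T T (inv_into (carrier G) f)}\<rparr>"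

definition identity_nhds :: "('a, 'b) monoid_scheme \<Rightarrow> 'a topology \<Rightarrow> 'a set set" where
  "identity_nhds G T =
     {V. V \<subseteq> carrier G \<and> (\<exists>U. openin T U \<and> \<one>\<^bsub>G\<^esub> \<in> U \<and> U \<subseteq> V)}"

text \<open>
  As in the type class \<^class>\<open>uniform_space\<close>, a uniform structure on a set \<open>S\<close> is represented
  by the filter of its entourages, here on pairs of elements of \<open>S\<close>: a set \<open>E\<close> is an entourage of
  \<open>\<U>\<close> iff \<open>\<forall>\<^sub>F p in \<U>. p \<in> E\<close>. Only the part of \<open>E\<close> inside \<open>S \<times> S\<close> matters. The uniform structure
  generated by a family of sets is the infimum of the corresponding principal filters.
\<close>

definition left_uniformity ::
    "('a, 'b) monoid_scheme \<Rightarrow> 'a topology \<Rightarrow> ('a \<times> 'a) filter" where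
  "left_uniformity G T = (INF V\<in>identity_nhds G T. principal
     {(x, y). x \<in> carrier G \<and> y \<in> carrier G \<and> inv\<^bsub>G\<^esub> x \<otimes>\<^bsub>G\<^esub> y \<in> V})"

definition right_uniformity ::
    "('a, 'b) monoid_scheme \<Rightarrow> 'a topology \<Rightarrow> ('a \<times> 'a) filter" where
  "right_uniformity G T = (INF V\<in>identity_nhds G T. principal
     {(x, y). x \<in> carrier G \<and> y \<in> carrier G \<and> x \<otimes>\<^bsub>G\<^esub> inv\<^bsub>G\<^esub> y \<in> V})"

definition upper_uniformity ::
    "('a, 'b) monoid_scheme \<Rightarrow> 'a topology \<Rightarrow> ('a \<times> 'a) filter" where
  "upper_uniformity G T = (INF V\<in>identity_nhds G T. principal
     {(x, y). x \<in> carrier G \<and> y \<in> carrier G \<and>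
        inv\<^bsub>G\<^esub> x \<otimes>\<^bsub>G\<^esub> y \<in> V \<and> x \<otimes>\<^bsub>G\<^esub> inv\<^bsub>G\<^esub> y \<in> V})"

definition bounded_in_group ::
    "('a, 'b) monoid_scheme \<Rightarrow> 'a topology \<Rightarrow> 'a set \<Rightarrow> bool" where
  "bounded_in_group G T B \<longleftrightarrow> B \<subseteq> carrier G \<and>
     (\<forall>V :: nat \<Rightarrow> 'a set.
        incseq V \<and> (\<forall>n. openin T (V n)) \<and> (\<Union>n. V n) = carrier G \<and>
        (\<forall>n. V n <#>\<^bsub>G\<^esub> V n \<subseteq> V (Suc n))
        \<longrightarrow> (\<exists>k. B \<subseteq> V k))"

definition bounded_convergence_uniformity ::
    "('a, 'b) monoid_scheme \<Rightarrow> 'a topology \<Rightarrow> ('a \<times> 'a) filter \<Rightarrow> ('a \<Rightarrow> 'a) set \<Rightarrow>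
     (('a \<Rightarrow> 'a) \<times> ('a \<Rightarrow> 'a)) filter" where
  "bounded_convergence_uniformity G T \<U> A =
     (INF (B, E)\<in>{B. bounded_in_group G T B} \<times> {E. \<forall>\<^sub>F p in \<U>. p \<in> E}. principal
        {(f, g). f \<in> A \<and> g \<in> A \<and> (\<forall>x\<in>B. (f x, g x) \<in> E)})"

end

theory Submission
  imports Defs
begin

text \<open>
  Inversion exchanges the left and the right uniform structure, and automorphisms commute with
  inversion: \<open>f(x) g(x)\<inverse> = f(x\<inverse>)\<inverse> g(x\<inverse>)\<close>. Hence \<open>f\<close> and \<open>g\<close> are right-close on \<open>B\<close> exactly when
  they are left-close on \<open>B\<inverse>\<close>. Since the inverse of a bounded set is bounded
  (\<open>bounded_in_group_inverse_image\<close>), \<open>B \<mapsto> B\<inverse>\<close> only permutes the bounded sets, and the left and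
  the right structure of bounded convergence have the same generators. Each generator of the
  upper structure is the intersection of a left and a right one, so the upper structure is the
  infimum of two equal filters.
\<close>

text \<open>
  Uniform closeness on a bounded set can be tested on a base of entourages, so that only the
  identity neighbourhoods matter below.
\<close>

lemma bounded_convergence_uniformity_base:
  assumes "I \<noteq> {}"
    and directed: "\<And>i j. i \<in> I \<Longrightarrow> j \<in> I \<Longrightarrow> \<exists>k\<in>I. E k \<subseteq> E i \<inter> E j"
  shows "bounded_convergence_uniformity G T (INF i\<in>I. principal (E i)) A =
    (INF B\<in>{B. bounded_in_group G T B}. INF i\<in>I.
       principal {(f, g). f \<in> A \<and> g \<in> A \<and> (\<forall>x\<in>B. (f x, g x) \<in> E i)})"
    (is "?L = ?R")
proof (rule antisym)
  have ev: "(\<forall>\<^sub>F p in (INF i\<in>I. principal (E i)). p \<in> D) \<longleftrightarrow> (\<exists>i\<in>I. E i \<subseteq> D)" for D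
    using directed
    by (subst eventually_INF_base[OF \<open>I \<noteq> {}\<close>]) (auto simp: eventually_principal)
  show "?L \<le> ?R"
  proof (intro INF_greatest)
    fix B i assume "B \<in> {B. bounded_in_group G T B}" "i \<in> I"
    then show "?L \<le> principal {(f, g). f \<in> A \<and> g \<in> A \<and> (\<forall>x\<in>B. (f x, g x) \<in> E i)}"
      unfolding bounded_convergence_uniformity_def
      by (intro INF_lower2[of "(B, E i)"]) (auto simp: ev)
  qed
  show "?R \<le> ?L"
    unfolding bounded_convergence_uniformity_def
  proof (rule INF_greatest, clarify)
    fix B D assume B: "bounded_in_group G T B"
      and "\<forall>\<^sub>F p in (INF i\<in>I. principal (E i)). p \<in> D"
    then obtain i where "i \<in> I" "E i \<subseteq> D"
      using ev by blast
    then show "?R \<le> principal {(f, g). f \<in> A \<and> g \<in> A \<and> (\<forall>x\<in>B. (f x, g x) \<in> D)}"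
      using B by (intro INF_lower2[of B] INF_lower2[of i]) auto
  qed
qed

lemma carrier_bicontinuous_AutoGroup_subset_hom:
  "carrier (bicontinuous_AutoGroup G T) \<subseteq> hom G G"
  by (auto simp: bicontinuous_AutoGroup_def auto_def)

lemma identity_nhds_Int:
  "V \<in> identity_nhds G T \<Longrightarrow> W \<in> identity_nhds G T \<Longrightarrow> V \<inter> W \<in> identity_nhds G T"
  unfolding identity_nhds_def by (blast intro: openin_Int)

context topological_group
begin

lemma identity_nhds_nonempty: "identity_nhds G T \<noteq> {}"
  using openin_topspace[of T] by (auto simp: identity_nhds_def topspace_eq_carrier)

text \<open>
  Inverting an exhaustion \<open>(V\<^sub>n)\<close> that tests boundedness gives another one, because
  \<open>V\<inverse> V\<inverse> = (V V)\<inverse>\<close>. Preimages under inversion stand for \<open>V\<inverse>\<close>, which makes openness immediate.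
\<close>

lemma bounded_in_group_inverse_image:
  assumes B: "bounded_in_group G T B"
  shows "bounded_in_group G T ((\<lambda>x. inv x) ` B)"
  unfolding bounded_in_group_def
proof (intro conjI allI impI; (elim conjE)?)
  show "(\<lambda>x. inv x) ` B \<subseteq> carrier G"
    using B by (auto simp: bounded_in_group_def)
next
  fix V :: "nat \<Rightarrow> 'a set"
  assume V: "incseq V" "\<forall>n. openin T (V n)" "(\<Union>n. V n) = carrier G"
    "\<forall>n. V n <#> V n \<subseteq> V (Suc n)"
  define W where "W n = {x \<in> carrier G. inv x \<in> V n}" for n
  have "incseq W"
    using V(1) by (auto simp: W_def incseq_def)
  moreover have "openin T (W n)" for n
    using openin_continuous_map_preimage[OF continuous_inverse, of "V n"] V(2)
    by (simp add: W_def topspace_eq_carrier)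
  moreover have "(\<Union>n. W n) = carrier G"
    using V(3) by (auto simp: W_def)
  moreover have "W n <#> W n \<subseteq> W (Suc n)" for n
  proof
    fix z assume "z \<in> W n <#> W n"
    then obtain x y where xy: "z = x \<otimes> y" "x \<in> W n" "y \<in> W n"
      by (auto simp: set_mult_def)
    then have "inv y \<otimes> inv x \<in> V n <#> V n"
      by (auto simp: W_def set_mult_def)
    then show "z \<in> W (Suc n)"
      using xy V(4) by (auto simp: W_def inv_mult_group)
  qed
  ultimately obtain k where "B \<subseteq> W k"
    using B[unfolded bounded_in_group_def, THEN conjunct2, rule_format, of W] by blast
  then show "\<exists>k. (\<lambda>x. inv x) ` B \<subseteq> V k"
    by (auto simp: W_def)
qed

definition left_close_on :: "('a \<Rightarrow> 'a) set \<Rightarrow> 'a set \<Rightarrow> 'a set \<Rightarrow> (('a \<Rightarrow> 'a) \<times> ('a \<Rightarrow> 'a)) set"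
  where "left_close_on A B V = {(f, g). f \<in> A \<and> g \<in> A \<and> (\<forall>x\<in>B. inv (f x) \<otimes> g x \<in> V)}"

text \<open>Right-closeness at \<open>x\<close> is by this identity left-closeness at \<open>x\<inverse>\<close>.\<close>

lemma hom_mult_inv_eq_at_inverse:
  assumes "f \<in> hom G G" "g \<in> hom G G" "x \<in> carrier G"
  shows "f x \<otimes> inv (g x) = inv (f (inv x)) \<otimes> g (inv x)"
proof -
  interpret f: group_hom G G f
    using assms by unfold_locales
  interpret g: group_hom G G g
    using assms by unfold_locales
  show ?thesis
    using assms by simp
qed

lemma bounded_convergence_left:
  assumes "A \<subseteq> hom G G"
  shows "bounded_convergence_uniformity G T (left_uniformity G T) A =
    (INF B\<in>{B. bounded_in_group G T B}. INF V\<in>identity_nhds G T.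
       principal (left_close_on A B V))"
  unfolding left_uniformity_def
proof (subst bounded_convergence_uniformity_base[OF identity_nhds_nonempty], goal_cases)
  case (1 V W)
  then show ?case
    by (intro bexI[of _ "V \<inter> W"] identity_nhds_Int) auto
next
  case 2
  have "{(f, g). f \<in> A \<and> g \<in> A \<and>
         (\<forall>x\<in>B. (f x, g x) \<in> {(x, y). x \<in> carrier G \<and> y \<in> carrier G \<and> inv x \<otimes> y \<in> V})} =
      left_close_on A B V" if "bounded_in_group G T B" for B V
  proof -
    have "x \<in> carrier G" if "x \<in> B" for x
      using \<open>bounded_in_group G T B\<close> that by (auto simp: bounded_in_group_def)
    moreover have "f \<in> hom G G" if "f \<in> A" for f
      using assms that by blast
    ultimately show ?thesis
      by (auto simp: left_close_on_def intro: hom_in_carrier)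
  qed
  then show ?case
    by simp
qed

lemma bounded_convergence_right:
  assumes "A \<subseteq> hom G G"
  shows "bounded_convergence_uniformity G T (right_uniformity G T) A =
    (INF B\<in>{B. bounded_in_group G T B}. INF V\<in>identity_nhds G T.
       principal (left_close_on A ((\<lambda>x. inv x) ` B) V))"
  unfolding right_uniformity_def
proof (subst bounded_convergence_uniformity_base[OF identity_nhds_nonempty], goal_cases)
  case (1 V W)
  then show ?case
    by (intro bexI[of _ "V \<inter> W"] identity_nhds_Int) auto
next
  case 2
  have "{(f, g). f \<in> A \<and> g \<in> A \<and>
         (\<forall>x\<in>B. (f x, g x) \<in> {(x, y). x \<in> carrier G \<and> y \<in> carrier G \<and> x \<otimes> inv y \<in> V})} =
      left_close_on A ((\<lambda>x. inv x) ` B) V" if "bounded_in_group G T B" for B V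
  proof -
    have "x \<in> carrier G" if "x \<in> B" for x
      using \<open>bounded_in_group G T B\<close> that by (auto simp: bounded_in_group_def)
    moreover have "f \<in> hom G G" if "f \<in> A" for f
      using assms that by blast
    ultimately show ?thesis
      by (auto simp: left_close_on_def hom_mult_inv_eq_at_inverse
          intro: hom_in_carrier)
  qed
  then show ?case
    by simp
qed

lemma bounded_convergence_upper:
  assumes "A \<subseteq> hom G G"
  shows "bounded_convergence_uniformity G T (upper_uniformity G T) A =
    (INF B\<in>{B. bounded_in_group G T B}. INF V\<in>identity_nhds G T.
       inf (principal (left_close_on A B V))
         (principal (left_close_on A ((\<lambda>x. inv x) ` B) V)))"
  unfolding upper_uniformity_def
proof (subst bounded_convergence_uniformity_base[OF identity_nhds_nonempty], goal_cases)
  case (1 V W)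
  then show ?case
    by (intro bexI[of _ "V \<inter> W"] identity_nhds_Int) auto
next
  case 2
  have "{(f, g). f \<in> A \<and> g \<in> A \<and>
         (\<forall>x\<in>B. (f x, g x) \<in> {(x, y). x \<in> carrier G \<and> y \<in> carrier G \<and>
            inv x \<otimes> y \<in> V \<and> x \<otimes> inv y \<in> V})} =
      left_close_on A B V \<inter> left_close_on A ((\<lambda>x. inv x) ` B) V"
    if "bounded_in_group G T B" for B V
  proof -
    have "x \<in> carrier G" if "x \<in> B" for x
      using \<open>bounded_in_group G T B\<close> that by (auto simp: bounded_in_group_def)
    moreover have "f \<in> hom G G" if "f \<in> A" for f
      using assms that by blast
    ultimately show ?thesis
      by (auto simp: left_close_on_def hom_mult_inv_eq_at_inverse
          intro: hom_in_carrier)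
  qed
  then show ?case
    by simp
qed

lemma image_inverse_bounded_sets:
  "(`) (\<lambda>x. inv x) ` {B. bounded_in_group G T B} = {B. bounded_in_group G T B}"
proof (intro equalityI subsetI)
  fix B assume "B \<in> {B. bounded_in_group G T B}"
  moreover from this have "B = (\<lambda>x. inv x) ` (\<lambda>x. inv x) ` B"
    by (force simp: bounded_in_group_def image_image)
  ultimately show "B \<in> (`) (\<lambda>x. inv x) ` {B. bounded_in_group G T B}"
    by (intro image_eqI[of _ _ "(\<lambda>x. inv x) ` B"]) (auto intro: bounded_in_group_inverse_image)
qed (auto intro: bounded_in_group_inverse_image)

lemma bounded_convergence_left_eq_right:
  assumes "A \<subseteq> hom G G"
  shows "bounded_convergence_uniformity G T (left_uniformity G T) A =
    bounded_convergence_uniformity G T (right_uniformity G T) A"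
  unfolding bounded_convergence_left[OF assms] bounded_convergence_right[OF assms]
  \<comment> \<open>The bounded sets of the left-hand side are reindexed by \<open>B \<mapsto> B\<inverse>\<close>.\<close>
  by (subst image_inverse_bounded_sets[symmetric]) (simp add: image_image)

lemma bounded_convergence_upper_eq_inf:
  assumes "A \<subseteq> hom G G"
  shows "bounded_convergence_uniformity G T (upper_uniformity G T) A =
    inf (bounded_convergence_uniformity G T (left_uniformity G T) A)
      (bounded_convergence_uniformity G T (right_uniformity G T) A)"
  unfolding bounded_convergence_left[OF assms] bounded_convergence_right[OF assms]
    bounded_convergence_upper[OF assms] INF_inf_distrib ..

end

theorem proposition3p2:
  fixes G :: "('a, 'b) monoid_scheme" and T :: "'a topology"
  assumes "topological_group G T"
  shows "bounded_convergence_uniformity G T (left_uniformity G T)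
             (carrier (bicontinuous_AutoGroup G T)) =
           bounded_convergence_uniformity G T (right_uniformity G T)
             (carrier (bicontinuous_AutoGroup G T)) \<and>
         bounded_convergence_uniformity G T (right_uniformity G T)
             (carrier (bicontinuous_AutoGroup G T)) =
           bounded_convergence_uniformity G T (upper_uniformity G T)
             (carrier (bicontinuous_AutoGroup G T))"
proof -
  interpret topological_group G T by fact
  show ?thesis
    using bounded_convergence_left_eq_right[OF carrier_bicontinuous_AutoGroup_subset_hom]
      bounded_convergence_upper_eq_inf[OF carrier_bicontinuous_AutoGroup_subset_hom]
    by simp
qed

end
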